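(* Let $(X_1,f_1)$ and $(X_2,f_2)$ be dynamical systems and $h:X_1\to X_2$ a continuous surjection with $h\circ f_1=f_2\circ h$. If $(X_1,f_1)$ satisfies TRAC 1 and TRAC 2 with respect to a background measure $\mu_0$ (with ergodic measures $\mu_1,\dots,\mu_k$), then $(X_2,f_2)$ satisfies TRAC 1 and TRAC 2 with respect to the background measure $h_*\mu_0$ (with ergodic measures $h_*\mu_1,\dots,h_*\mu_k$). If in addition $h$ is almost open and $(X_1,f_1)$ satisfies TRAC 3, then $(X_2,f_2)$ satisfies TRAC 3. If in addition $h$ is $\mu_0$ almost one-to-one and $(X_1,f_1)$ satisfies TRAC 4, then $(X_2,f_2)$ satisfies TRAC 4.
   Context: Dynamical system: compact metric $X$ with continuous $f$. Background measure: a complete full Borel probability measure (full = every nonempty open set has positive measure). Basic sets are chain components of $f$; the basin of a basic set $B$ is $G(B)=\operatorname{int}\{x:\omega f(x)\subset B\}$ ($\omega f(x)$ the limit set of the forward orbit), and $B$ is visible if $G(B)\ne\emptyset$. $Gen(\mu)$ is the set of points $x$ with $\frac1n\sum_{i<n}u(f^ix)\to\int u\,d\mu$ for all continuous $u$; $|\mu|$ is the support. Tractability conditions with respect to $\mu_0$: TRAC 1: finitely many basic sets. TRAC 2: there are finitely many ergodic invariant probability measures $\mu_1,\dots,\mu_k$ such that every point outside some $\mu_0$-null set is generic for some $\mu_i$. TRAC 3: each $|\mu_i|$ is contained in a visible basic set. TRAC 4: for $i\ne j$, $\mu_0(|\mu_i|\cap|\mu_j|)=0$. $h$ is almost open if $h(U)$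 has nonempty interior whenever $U$ does; $h$ is $\mu_0$ almost one-to-one if $\mu_0(\{x:h^{-1}(h(x))=\{x\}\})=1$. *)

theory Defs
  imports "HOL-Probability.Probability"
begin

definition dyn_system :: "'a::metric_space set \<Rightarrow> ('a \<Rightarrow> 'a) \<Rightarrow> bool" where
  "dyn_system X f \<longleftrightarrow> compact X \<and> continuous_on X f \<and> f ` X \<subseteq> X"

definition chain_rel :: "'a::metric_space set \<Rightarrow> ('a \<Rightarrow> 'a) \<Rightarrow> 'a \<Rightarrow> 'a \<Rightarrow> bool" where
  "chain_rel X f x y \<longleftrightarrow>
     (\<forall>e>0. \<exists>n>0. \<exists>c::nat \<Rightarrow> 'a. c 0 = x \<and> c n = y \<and> (\<forall>i\<le>n. c i \<in> X) \<and>
        (\<forall>i<n. dist (f (c i)) (c (Suc i)) < e))"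

definition basic_sets :: "'a::metric_space set \<Rightarrow> ('a \<Rightarrow> 'a) \<Rightarrow> 'a set set" where
  "basic_sets X f =
     {{y \<in> X. chain_rel X f x y \<and> chain_rel X f y x} | x. x \<in> X \<and> chain_rel X f x x}"

definition omega_limit :: "('a \<Rightarrow> 'a) \<Rightarrow> 'a \<Rightarrow> 'a::metric_space set" where
  "omega_limit f x = {y. \<forall>e>0. \<forall>N. \<exists>n\<ge>N. dist ((f ^^ n) x) y < e}"

definition basin :: "'a::metric_space set \<Rightarrow> ('a \<Rightarrow> 'a) \<Rightarrow> 'a set \<Rightarrow> 'a set" where
  "basin X f B = (top_of_set X) interior_of {x \<in> X. omega_limit f x \<subseteq> B}"

definition visible :: "'a::metric_space set \<Rightarrow> ('a \<Rightarrow> 'a) \<Rightarrow> 'a set \<Rightarrow> bool" where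
  "visible X f B \<longleftrightarrow> basin X f B \<noteq> {}"

text \<open>Background measure: a full Borel probability measure on X. Completeness is accounted
  for by expressing all null-set statements via AE (subsets of null sets).\<close>
definition background_measure :: "'a::metric_space set \<Rightarrow> 'a measure \<Rightarrow> bool" where
  "background_measure X m \<longleftrightarrow> prob_space m \<and> sets m = sets (restrict_space borel X) \<and>
     (\<forall>U. openin (top_of_set X) U \<and> U \<noteq> {} \<longrightarrow> emeasure m U > 0)"

definition invariant_prob :: "'a::metric_space set \<Rightarrow> ('a \<Rightarrow> 'a) \<Rightarrow> 'a measure \<Rightarrow> bool" where
  "invariant_prob X f m \<longleftrightarrow> prob_space m \<and> sets m = sets (restrict_space borel X) \<and>
     (\<forall>A \<in> sets m. emeasure m (f -` A \<inter> X) = emeasure m A)"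

definition ergodic :: "'a::metric_space set \<Rightarrow> ('a \<Rightarrow> 'a) \<Rightarrow> 'a measure \<Rightarrow> bool" where
  "ergodic X f m \<longleftrightarrow> invariant_prob X f m \<and>
     (\<forall>A \<in> sets m. f -` A \<inter> X = A \<longrightarrow> emeasure m A = 0 \<or> emeasure m A = 1)"

definition support :: "'a::metric_space set \<Rightarrow> 'a measure \<Rightarrow> 'a set" where
  "support X m = {x \<in> X. \<forall>U. openin (top_of_set X) U \<and> x \<in> U \<longrightarrow> emeasure m U > 0}"

definition Gen :: "'a::metric_space set \<Rightarrow> ('a \<Rightarrow> 'a) \<Rightarrow> 'a measure \<Rightarrow> 'a set" where
  "Gen X f m = {x \<in> X. \<forall>u::'a \<Rightarrow> real. continuous_on X u \<longrightarrow>
      (\<lambda>n. (\<Sum>i<n. u ((f ^^ i) x)) / real n) \<longlonglongrightarrow> integral\<^sup>L m u}"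

definition pushforward :: "'b::metric_space set \<Rightarrow> ('a \<Rightarrow> 'b) \<Rightarrow> 'a measure \<Rightarrow> 'b measure" where
  "pushforward Y h m = distr m (restrict_space borel Y) h"

definition TRAC1 :: "'a::metric_space set \<Rightarrow> ('a \<Rightarrow> 'a) \<Rightarrow> bool" where
  "TRAC1 X f \<longleftrightarrow> finite (basic_sets X f)"

definition TRAC2 :: "'a::metric_space set \<Rightarrow> ('a \<Rightarrow> 'a) \<Rightarrow> 'a measure \<Rightarrow> nat \<Rightarrow> (nat \<Rightarrow> 'a measure) \<Rightarrow> bool" where
  "TRAC2 X f m0 k mu \<longleftrightarrow> (\<forall>i<k. ergodic X f (mu i)) \<and>
     (AE x in m0. \<exists>i<k. x \<in> Gen X f (mu i))"

definition TRAC3 :: "'a::metric_space set \<Rightarrow> ('a \<Rightarrow> 'a) \<Rightarrow> nat \<Rightarrow> (nat \<Rightarrow> 'a measure) \<Rightarrow> bool" where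
  "TRAC3 X f k mu \<longleftrightarrow>
     (\<forall>i<k. \<exists>B \<in> basic_sets X f. support X (mu i) \<subseteq> B \<and> visible X f B)"

definition TRAC4 :: "'a::metric_space set \<Rightarrow> 'a measure \<Rightarrow> nat \<Rightarrow> (nat \<Rightarrow> 'a measure) \<Rightarrow> bool" where
  "TRAC4 X m0 k mu \<longleftrightarrow>
     (\<forall>i<k. \<forall>j<k. i \<noteq> j \<longrightarrow> emeasure m0 (support X (mu i) \<inter> support X (mu j)) = 0)"

definition almost_open :: "'a::metric_space set \<Rightarrow> 'b::metric_space set \<Rightarrow> ('a \<Rightarrow> 'b) \<Rightarrow> bool" where
  "almost_open X Y h \<longleftrightarrow> (\<forall>U. openin (top_of_set X) U \<and> U \<noteq> {} \<longrightarrow>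
      (top_of_set Y) interior_of (h ` U) \<noteq> {})"

text \<open>Almost one-to-one: the set of points with singleton fibre has full measure
  (for a complete measure this is the AE statement).\<close>
definition almost_one_to_one :: "'a::metric_space set \<Rightarrow> 'a measure \<Rightarrow> ('a \<Rightarrow> 'b) \<Rightarrow> bool" where
  "almost_one_to_one X m h \<longleftrightarrow> (AE x in m. {y \<in> X. h y = h x} = {x})"

end

theory Submission
  imports Defs
begin

text \<open>Lifting a chain recurrent point of the factor and passing to a limit point of the lifted orbit
  shows that every basic set of \<open>f2\<close> contains the image of a basic set of \<open>f1\<close>; since basic sets
  are disjoint, there are at most as many of the former as of the latter. A point of \<open>X2\<close> whose
  compact fibre misses \<open>support X1 (mu i)\<close> has a neighbourhood with null preimage, so the support
  of the image measure lies in the image of the support; this and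
  \<open>omega_limit f2 (h x) = h ` omega_limit f1 x\<close> give TRAC 3. For TRAC 4, a point with a singleton
  fibre that maps into two image supports already lies in both supports.\<close>

section \<open>Chains as transitive closures of approximate steps\<close>

text \<open>Membership of both endpoints is built in, so a path of steps stays in \<open>X\<close>
  and chains can be handled by closure reasoning for a relation.\<close>

definition eps_step :: "'a::metric_space set \<Rightarrow> ('a \<Rightarrow> 'a) \<Rightarrow> real \<Rightarrow> 'a \<Rightarrow> 'a \<Rightarrow> bool" where
  "eps_step X f e a b \<longleftrightarrow> a \<in> X \<and> b \<in> X \<and> dist (f a) b < e"

lemma eps_step_mono: "eps_step X f d a b \<Longrightarrow> d \<le> e \<Longrightarrow> eps_step X f e a b"
  by (auto simp: eps_step_def)

lemma eps_chain_mono: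
  assumes "(eps_step X f d)\<^sup>*\<^sup>* a b" "d \<le> e"
  shows "(eps_step X f e)\<^sup>*\<^sup>* a b"
  using assms(1)
proof induction
  case (step b c)
  with eps_step_mono[OF step(2) assms(2)] show ?case by simp
qed simp

text \<open>The requirement \<open>n > 0\<close> corresponds to the transitive rather than the
  reflexive closure. Concatenation and induction on chains then come for free.\<close>

lemma chain_rel_iff_tranclp: "chain_rel X f x y \<longleftrightarrow> (\<forall>e>0. (eps_step X f e)\<^sup>+\<^sup>+ x y)"
proof -
  have "(eps_step X f e)\<^sup>+\<^sup>+ x y \<longleftrightarrow>
        (\<exists>n>0. \<exists>c. c 0 = x \<and> c n = y \<and> (\<forall>i\<le>n. c i \<in> X) \<and> (\<forall>i<n. dist (f (c i)) (c (Suc i)) < e))" for e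
  proof -
    have key: "c 0 = x \<and> c n = y \<and> (\<forall>i<n. eps_step X f e (c i) (c (Suc i))) \<longleftrightarrow>
          c 0 = x \<and> c n = y \<and> (\<forall>i\<le>n. c i \<in> X) \<and> (\<forall>i<n. dist (f (c i)) (c (Suc i)) < e)"
      if "n > 0" for n and c :: "nat \<Rightarrow> 'a"
    proof -
      have "c i \<in> X" if "\<forall>i<n. eps_step X f e (c i) (c (Suc i))" "i \<le> n" for i
      proof (cases "i < n")
        case True
        then show ?thesis using that by (auto simp: eps_step_def)
      next
        case False
        \<comment> \<open>The last index has no outgoing step, so its membership is read off the
          step that enters it.\<close>
        then have "i = Suc (n - 1)" "n - 1 < n" using that \<open>n > 0\<close> by auto
        then show ?thesis using that(1) by (metis eps_step_def)
      qed
      then have "(\<forall>i<n. eps_step X f e (c i) (c (Suc i))) \<longleftrightarrow>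
          (\<forall>i\<le>n. c i \<in> X) \<and> (\<forall>i<n. dist (f (c i)) (c (Suc i)) < e)"
        unfolding eps_step_def by (meson Suc_leI less_imp_le_nat)
      then show ?thesis by (rule arg_cong)
    qed
    show ?thesis
      unfolding tranclp_power relpowp_fun_conv
      by (intro iff_exI, rule conj_cong[OF refl], rule iff_exI, rule key)
  qed
  then show ?thesis unfolding chain_rel_def by simp
qed

lemma chain_rel_in: "chain_rel X f x y \<Longrightarrow> x \<in> X \<and> y \<in> X"
  unfolding chain_rel_def by (metis le0 le_refl zero_less_one)

lemma chain_rel_trans: "chain_rel X f x y \<Longrightarrow> chain_rel X f y z \<Longrightarrow> chain_rel X f x z"
  unfolding chain_rel_iff_tranclp by (meson tranclp_trans)

lemma dyn_system_delta:
  assumes "dyn_system X f" "x \<in> X" "e > 0"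
  obtains d where "d > 0" "\<And>y. y \<in> X \<Longrightarrow> dist y x < d \<Longrightarrow> dist (f y) (f x) < e"
  using assms unfolding dyn_system_def continuous_on_iff by metis

lemma funpow_in: "f ` X \<subseteq> X \<Longrightarrow> x \<in> X \<Longrightarrow> (f ^^ n) x \<in> X"
  by (induction n) auto

text \<open>Moving the starting point affects only the first jump: continuity costs
  \<open>e/2\<close> there, and the original chain uses the other \<open>e/2\<close>.\<close>

lemma chain_rel_closed_left:
  assumes X: "dyn_system X f" "x \<in> X"
    and near: "\<And>d. d > 0 \<Longrightarrow> \<exists>x'\<in>X. dist x' x < d \<and> chain_rel X f x' y"
  shows "chain_rel X f x y"
  unfolding chain_rel_iff_tranclp
proof (intro allI impI)
  fix e :: real assume e: "e > 0"
  then obtain d where d: "d > 0" "\<And>z. z \<in> X \<Longrightarrow> dist z x < d \<Longrightarrow> dist (f z) (f x) < e/2"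
    using dyn_system_delta[OF X, of "e/2"] by auto
  obtain x' where x': "x' \<in> X" "dist x' x < d" "chain_rel X f x' y"
    using near d by blast
  then have "(eps_step X f (e/2))\<^sup>+\<^sup>+ x' y" using e unfolding chain_rel_iff_tranclp by simp
  then obtain z where z: "eps_step X f (e/2) x' z" "(eps_step X f (e/2))\<^sup>*\<^sup>* z y"
    by (meson tranclpD)
  have "dist (f x) z < e"
    using z(1) d(2)[OF x'(1,2)] unfolding eps_step_def
    by (metis dist_commute dist_triangle_half_r)
  then have "eps_step X f e x z" using z(1) X(2) by (auto simp: eps_step_def)
  moreover have "(eps_step X f e)\<^sup>*\<^sup>* z y" using eps_chain_mono[OF z(2)] e by simp
  ultimately show "(eps_step X f e)\<^sup>+\<^sup>+ x y" by (rule rtranclp_into_tranclp2)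
qed

text \<open>If a chain from \<open>w\<close> to \<open>x\<close> begins \<open>w, a, b\<close>, then
  \<open>f w\<close> is close to \<open>a\<close>, so \<open>f (f w)\<close> is close to
  \<open>f a\<close> and hence to \<open>b\<close>. A chain from \<open>f w\<close> can therefore
  jump straight to \<open>b\<close>.\<close>

lemma chain_rel_funpow_left:
  assumes X: "dyn_system X f" and x: "chain_rel X f x x"
  shows "chain_rel X f ((f ^^ n) x) x"
proof (induction n)
  case 0
  then show ?case using x by simp
next
  case (Suc n)
  define w where "w = (f ^^ n) x"
  have wX: "w \<in> X" "f w \<in> X"
    using chain_rel_in[OF Suc] X by (auto simp: w_def dyn_system_def)
  have "chain_rel X f (f w) x"
    unfolding chain_rel_iff_tranclp
  proof (intro allI impI)
    fix e :: real assume e: "e > 0"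
    then obtain d where d: "d > 0" "\<And>z. z \<in> X \<Longrightarrow> dist z (f w) < d \<Longrightarrow> dist (f z) (f (f w)) < e/2"
      using dyn_system_delta[OF X wX(2), of "e/2"] by auto
    \<comment> \<open>The bound \<open>d\<close> lets continuity at \<open>f w\<close> apply to
      \<open>a\<close>; the bound \<open>e/2\<close> controls the jump from \<open>a\<close> to
      \<open>b\<close>.\<close>
    define r where "r = min d (e/2)"
    have r: "r > 0" "r \<le> d" "r \<le> e/2" using d e by (auto simp: r_def)
    have wx: "(eps_step X f r)\<^sup>+\<^sup>+ w x" and xx: "(eps_step X f r)\<^sup>+\<^sup>+ x x"
      using Suc x r unfolding chain_rel_iff_tranclp w_def by auto
    from wx obtain a where a: "eps_step X f r w a" "(eps_step X f r)\<^sup>*\<^sup>* a x"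
      by (meson tranclpD)
    \<comment> \<open>The first step may already end at \<open>x\<close>; appending a chain from
      \<open>x\<close> to itself guarantees that a second step exists.\<close>
    have "(eps_step X f r)\<^sup>+\<^sup>+ a x" using a(2) xx by (rule rtranclp_tranclp_tranclp)
    then obtain b where b: "eps_step X f r a b" "(eps_step X f r)\<^sup>*\<^sup>* b x"
      by (meson tranclpD)
    have "dist (f a) (f (f w)) < e/2"
      using a(1) d(2)[of a] r by (auto simp: eps_step_def dist_commute)
    moreover have "dist (f a) b < e/2" using b(1) r by (auto simp: eps_step_def)
    ultimately have "dist (f (f w)) b < e" by (metis dist_commute dist_triangle_half_r)
    then have "eps_step X f e (f w) b" using b(1) wX by (auto simp: eps_step_def)
    moreover have "(eps_step X f e)\<^sup>*\<^sup>* b x" using eps_chain_mono[OF b(2)] r e by simp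
    ultimately show "(eps_step X f e)\<^sup>+\<^sup>+ (f w) x" by (rule rtranclp_into_tranclp2)
  qed
  then show ?case by (simp add: w_def)
qed

section \<open>Limit sets and chain recurrence\<close>

lemma omega_limit_in:
  assumes X: "dyn_system X f" and x: "x \<in> X" and z: "z \<in> omega_limit f x"
  shows "z \<in> X"
proof -
  have "closed X" using X by (simp add: dyn_system_def compact_imp_closed)
  moreover have "z \<in> closure X"
    unfolding closure_approachable
  proof (intro allI impI)
    fix e :: real assume "e > 0"
    then obtain n where "dist ((f ^^ n) x) z < e" using z unfolding omega_limit_def by blast
    moreover have "(f ^^ n) x \<in> X" using X x by (simp add: funpow_in dyn_system_def)
    ultimately show "\<exists>y\<in>X. dist y z < e" by blast
  qed
  ultimately show ?thesis by simp
qed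

lemma omega_limit_funpow:
  assumes "z \<in> omega_limit f x"
  shows "z \<in> omega_limit f ((f ^^ m) x)"
  unfolding omega_limit_def
proof (intro CollectI allI impI)
  fix e :: real and N assume "e > 0"
  then obtain n where n: "n \<ge> N + m" "dist ((f ^^ n) x) z < e"
    using assms unfolding omega_limit_def by blast
  then have "(f ^^ n) x = (f ^^ (n - m)) ((f ^^ m) x)"
    by (metis add_leD2 comp_apply funpow_add le_add_diff_inverse2)
  with n show "\<exists>n\<ge>N. dist ((f ^^ n) ((f ^^ m) x)) z < e"
    by (intro exI[of _ "n - m"]) auto
qed

text \<open>The orbit is a chain without error; only its last step is redirected, to
  \<open>z\<close> instead of the nearby orbit point.\<close>

lemma chain_rel_omega:
  assumes X: "dyn_system X f" and x: "x \<in> X" and z: "z \<in> omega_limit f x"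
  shows "chain_rel X f x z"
  unfolding chain_rel_iff_tranclp
proof (intro allI impI)
  fix e :: real assume e: "e > 0"
  have orb: "(f ^^ n) x \<in> X" for n using X x by (simp add: funpow_in dyn_system_def)
  \<comment> \<open>A positive time is chosen so that there is a last step to redirect.\<close>
  obtain n where n: "n \<ge> Suc 0" "dist ((f ^^ n) x) z < e"
    using e z unfolding omega_limit_def by blast
  then obtain m where m: "n = Suc m" by (cases n) auto
  have "(eps_step X f e)\<^sup>*\<^sup>* x ((f ^^ j) x)" for j
  proof (induction j)
    case (Suc j)
    have "eps_step X f e ((f ^^ j) x) ((f ^^ Suc j) x)"
      using orb[of j] orb[of "Suc j"] e by (simp add: eps_step_def)
    then show ?case using Suc by simp
  qed simp
  moreover have "eps_step X f e ((f ^^ m) x) z"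
    using n m orb omega_limit_in[OF X x z] by (simp add: eps_step_def)
  ultimately show "(eps_step X f e)\<^sup>+\<^sup>+ x z" by (rule rtranclp_into_tranclp1)
qed

lemma chain_rel_from_omega:
  assumes X: "dyn_system X f" and x: "x \<in> X" and z: "z \<in> omega_limit f x"
    and orb: "\<And>n. chain_rel X f ((f ^^ n) x) y"
  shows "chain_rel X f z y"
proof (rule chain_rel_closed_left[OF X omega_limit_in[OF X x z]])
  fix d :: real assume "d > 0"
  then obtain n where "dist ((f ^^ n) x) z < d" using z unfolding omega_limit_def by blast
  then show "\<exists>x'\<in>X. dist x' z < d \<and> chain_rel X f x' y"
    using orb chain_rel_in by metis
qed

text \<open>A limit point of an orbit is a limit point of each of its tails, so every orbit point
  chains to \<open>z\<close>; letting orbit points approach \<open>z\<close> moves the start of the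
  chain to \<open>z\<close> itself.\<close>

lemma omega_limit_chain_recurrent:
  assumes X: "dyn_system X f" and x: "x \<in> X" and z: "z \<in> omega_limit f x"
  shows "chain_rel X f z z"
proof (rule chain_rel_from_omega[OF assms])
  fix n
  show "chain_rel X f ((f ^^ n) x) z"
    using X x by (intro chain_rel_omega omega_limit_funpow z) (auto simp: funpow_in dyn_system_def)
qed

text \<open>The times \<open>t\<close> are left arbitrary so that times selected along an orbit of
  the factor can be reused for its lift.\<close>

lemma orbit_subseq_limit:
  assumes X: "dyn_system X f" and x: "x \<in> X" and t: "\<And>m. t m \<ge> m"
  obtains l r where "l \<in> omega_limit f x" "strict_mono (r :: nat \<Rightarrow> nat)"
    "(\<lambda>m. (f ^^ t (r m)) x) \<longlonglongrightarrow> l"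
proof -
  have "compact X" "\<forall>m. (f ^^ t m) x \<in> X" using X x by (auto simp: funpow_in dyn_system_def)
  then obtain l r where lr: "strict_mono r" "((\<lambda>m. (f ^^ t m) x) \<circ> r) \<longlonglongrightarrow> l"
    unfolding compact_def by metis
  then have lim: "(\<lambda>m. (f ^^ t (r m)) x) \<longlonglongrightarrow> l" by (simp add: o_def)
  have "l \<in> omega_limit f x"
    unfolding omega_limit_def
  proof (intro CollectI allI impI)
    fix e :: real and N assume "e > 0"
    then obtain M where M: "\<And>m. m \<ge> M \<Longrightarrow> dist ((f ^^ t (r m)) x) l < e"
      using lim unfolding lim_sequentially by blast
    \<comment> \<open>A strictly increasing \<open>r\<close> satisfies \<open>n \<le> r n\<close>,
      and \<open>t\<close> does not decrease its argument.\<close>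
    have "t (r (max M N)) \<ge> N"
      by (meson t seq_suble[OF lr(1)] max.cobounded2 order_trans)
    then show "\<exists>n\<ge>N. dist ((f ^^ n) x) l < e" using M[of "max M N"] by auto
  qed
  then show ?thesis using that lr lim by blast
qed

section \<open>Limit sets and chains under a semiconjugacy\<close>

lemma semiconj_funpow:
  assumes "f1 ` X \<subseteq> X" "\<forall>x\<in>X. h (f1 x) = f2 (h x)" "x \<in> X"
  shows "h ((f1 ^^ n) x) = (f2 ^^ n) (h x)"
  using assms by (induction n) (auto simp: funpow_in)

text \<open>One inclusion is continuity of \<open>h\<close>. For the other, compactness upstairs
  makes the lifted orbit converge along a subsequence of the times at which the image orbit
  approaches \<open>y\<close>; uniqueness of limits identifies \<open>y\<close>.\<close>

lemma omega_limit_semiconj: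
  assumes X: "dyn_system X f1" and h: "continuous_on X h" "\<forall>x\<in>X. h (f1 x) = f2 (h x)"
    and x: "x \<in> X"
  shows "omega_limit f2 (h x) = h ` omega_limit f1 x"
proof (intro equalityI subsetI)
  have orb: "(f1 ^^ n) x \<in> X" for n using X x by (simp add: funpow_in dyn_system_def)
  have conj: "h ((f1 ^^ n) x) = (f2 ^^ n) (h x)" for n
    using X x h(2) by (intro semiconj_funpow[of f1 X]) (auto simp: dyn_system_def)
  have tend: "(\<lambda>m. (f2 ^^ t m) (h x)) \<longlonglongrightarrow> h l"
    if "l \<in> omega_limit f1 x" "(\<lambda>m. (f1 ^^ t m) x) \<longlonglongrightarrow> l" for t l
    using continuous_on_tendsto_compose[OF h(1) that(2) omega_limit_in[OF X x that(1)]]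
    by (simp add: orb conj)
  {
    fix y assume y: "y \<in> omega_limit f2 (h x)"
    have "\<forall>m. \<exists>n\<ge>m. dist ((f2 ^^ n) (h x)) y < inverse (real (Suc m))"
      using y unfolding omega_limit_def by simp
    then obtain t where t: "\<And>m. t m \<ge> m" "\<And>m. dist ((f2 ^^ t m) (h x)) y < inverse (real (Suc m))"
      by metis
    obtain l r where lr: "l \<in> omega_limit f1 x" "strict_mono (r :: nat \<Rightarrow> nat)"
      "(\<lambda>m. (f1 ^^ t (r m)) x) \<longlonglongrightarrow> l"
      using orbit_subseq_limit[OF X x t(1)] by blast
    have "(\<lambda>m. dist ((f2 ^^ t m) (h x)) y) \<longlonglongrightarrow> 0"
      by (rule tendsto_sandwich[OF _ _ tendsto_const LIMSEQ_inverse_real_of_nat])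
         (use t(2) in \<open>auto intro!: always_eventually less_imp_le simp del: of_nat_Suc\<close>)
    then have "(\<lambda>m. (f2 ^^ t m) (h x)) \<longlonglongrightarrow> y" by (rule tendsto_dist_iff[THEN iffD2])
    then have "(\<lambda>m. (f2 ^^ t (r m)) (h x)) \<longlonglongrightarrow> y"
      using LIMSEQ_subseq_LIMSEQ[OF _ lr(2)] by (auto simp: o_def)
    with tend[OF lr(1,3)] have "h l = y" by (rule LIMSEQ_unique)
    then show "y \<in> h ` omega_limit f1 x" using lr(1) by blast
  }
  fix y assume "y \<in> h ` omega_limit f1 x"
  then obtain l where l: "l \<in> omega_limit f1 x" "y = h l" by blast
  show "y \<in> omega_limit f2 (h x)"
    unfolding omega_limit_def
  proof (intro CollectI allI impI)
    fix e :: real and N assume "e > 0"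
    then obtain d where d: "d > 0" "\<And>z. z \<in> X \<Longrightarrow> dist z l < d \<Longrightarrow> dist (h z) (h l) < e"
      using h(1) omega_limit_in[OF X x l(1)] unfolding continuous_on_iff by metis
    then obtain n where "n \<ge> N" "dist ((f1 ^^ n) x) l < d"
      using l(1) unfolding omega_limit_def by blast
    then show "\<exists>n\<ge>N. dist ((f2 ^^ n) (h x)) y < e"
      using d(2)[OF orb] by (auto simp: conj l(2))
  qed
qed

text \<open>Compactness makes \<open>h\<close> uniformly continuous, so a single \<open>d\<close>
  serves every step of a chain, whatever its length.\<close>

lemma chain_rel_semiconj:
  assumes X: "dyn_system X1 f1" and h: "continuous_on X1 h" "h ` X1 \<subseteq> X2"
      "\<forall>x\<in>X1. h (f1 x) = f2 (h x)"
    and xy: "chain_rel X1 f1 x y"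
  shows "chain_rel X2 f2 (h x) (h y)"
  unfolding chain_rel_iff_tranclp
proof (intro allI impI)
  fix e :: real assume e: "e > 0"
  have inv: "f1 ` X1 \<subseteq> X1" using X by (simp add: dyn_system_def)
  have "uniformly_continuous_on X1 h"
    using X h(1) by (simp add: compact_uniformly_continuous dyn_system_def)
  then obtain d where d: "d > 0"
    "\<And>a b. a \<in> X1 \<Longrightarrow> b \<in> X1 \<Longrightarrow> dist a b < d \<Longrightarrow> dist (h a) (h b) < e"
    using e unfolding uniformly_continuous_on_def by (metis dist_commute)
  have step: "eps_step X2 f2 e (h a) (h b)" if "eps_step X1 f1 d a b" for a b
    using that d(2)[of "f1 a" b] h inv by (auto simp: eps_step_def image_subset_iff)
  have "(eps_step X1 f1 d)\<^sup>+\<^sup>+ x y" using xy d(1) by (simp add: chain_rel_iff_tranclp)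
  then show "(eps_step X2 f2 e)\<^sup>+\<^sup>+ (h x) (h y)"
    by induction (auto intro: step tranclp.trancl_into_trancl)
qed

section \<open>Basic sets and their basins under a factor map\<close>

text \<open>Any point of a basic set may serve as its representative; hence two basic sets with a
  common point coincide.\<close>

lemma basic_sets_eq:
  assumes "B \<in> basic_sets X f" "x \<in> B"
  shows "B = {y \<in> X. chain_rel X f x y \<and> chain_rel X f y x}" "chain_rel X f x x"
  using assms unfolding basic_sets_def by (auto intro: chain_rel_trans)

lemma basic_sets_image:
  assumes X: "dyn_system X1 f1" and h: "continuous_on X1 h" "h ` X1 \<subseteq> X2"
      "\<forall>x\<in>X1. h (f1 x) = f2 (h x)"
    and B: "B \<in> basic_sets X1 f1"
  obtains C where "C \<in> basic_sets X2 f2" "h ` B \<subseteq> C"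
proof -
  obtain x where x: "x \<in> X1" "chain_rel X1 f1 x x"
    "B = {y \<in> X1. chain_rel X1 f1 x y \<and> chain_rel X1 f1 y x}"
    using B unfolding basic_sets_def by auto
  show ?thesis
  proof (rule that)
    show "{y \<in> X2. chain_rel X2 f2 (h x) y \<and> chain_rel X2 f2 y (h x)} \<in> basic_sets X2 f2"
      using x h(2) chain_rel_semiconj[OF X h x(2)] unfolding basic_sets_def by blast
    show "h ` B \<subseteq> {y \<in> X2. chain_rel X2 f2 (h x) y \<and> chain_rel X2 f2 y (h x)}"
      using x h(2) chain_rel_semiconj[OF X h] by auto
  qed
qed

text \<open>Chain recurrent points of the factor need not lift to chain recurrent points, but the limit
  points of any lift are chain recurrent and map into the same basic set.\<close>
lemma basic_sets_contains_image:
  assumes X: "dyn_system X1 f1" "dyn_system X2 f2"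
    and h: "continuous_on X1 h" "h ` X1 = X2" "\<forall>x\<in>X1. h (f1 x) = f2 (h x)"
    and C: "C \<in> basic_sets X2 f2"
  obtains B where "B \<in> basic_sets X1 f1" "h ` B \<subseteq> C"
proof -
  obtain y where y: "y \<in> X2" "chain_rel X2 f2 y y"
    "C = {z \<in> X2. chain_rel X2 f2 y z \<and> chain_rel X2 f2 z y}"
    using C unfolding basic_sets_def by auto
  obtain x where x: "x \<in> X1" "h x = y" using y h(2) by auto
  obtain l where l: "l \<in> omega_limit f1 x"
    using orbit_subseq_limit[OF X(1) x(1), of id] by auto
  have hl: "h l \<in> omega_limit f2 y"
    using omega_limit_semiconj[OF X(1) h(1,3) x(1)] l x by auto
  have yl: "chain_rel X2 f2 y (h l)" by (rule chain_rel_omega[OF X(2) y(1) hl])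
  \<comment> \<open>As \<open>y\<close> is chain recurrent, all its iterates chain back to
    \<open>y\<close>, and this property passes to limit points of the orbit.\<close>
  have ly: "chain_rel X2 f2 (h l) y"
    by (rule chain_rel_from_omega[OF X(2) y(1) hl chain_rel_funpow_left[OF X(2) y(2)]])
  have "h l \<in> C" using yl ly chain_rel_in[OF yl] y(3) by auto
  let ?B = "{z \<in> X1. chain_rel X1 f1 l z \<and> chain_rel X1 f1 z l}"
  have ll: "chain_rel X1 f1 l l" by (rule omega_limit_chain_recurrent[OF X(1) x(1) l])
  have B: "?B \<in> basic_sets X1 f1"
    using ll omega_limit_in[OF X(1) x(1) l] unfolding basic_sets_def by blast
  \<comment> \<open>The basic set that receives the image is obtained abstractly and then identified
    with \<open>C\<close> through the common point \<open>h l\<close>.\<close>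
  obtain C' where C': "C' \<in> basic_sets X2 f2" "h ` ?B \<subseteq> C'"
    using basic_sets_image[OF X(1) h(1) _ h(3) B, of X2] h(2) by auto
  have "h l \<in> C'" using C'(2) ll omega_limit_in[OF X(1) x(1) l] by auto
  then have "C' = C" using basic_sets_eq(1)[OF C'(1)] basic_sets_eq(1)[OF C \<open>h l \<in> C\<close>] by auto
  with that B C'(2) show ?thesis by blast
qed

lemma TRAC1_factor:
  assumes X: "dyn_system X1 f1" "dyn_system X2 f2"
    and h: "continuous_on X1 h" "h ` X1 = X2" "\<forall>x\<in>X1. h (f1 x) = f2 (h x)"
    and fin: "TRAC1 X1 f1"
  shows "TRAC1 X2 f2"
proof -
  have "\<forall>C\<in>basic_sets X2 f2. \<exists>B. B \<in> basic_sets X1 f1 \<and> h ` B \<subseteq> C"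
    by (rule ballI, rule basic_sets_contains_image[OF X h]) auto
  from bchoice[OF this] obtain g
    where g: "\<And>C. C \<in> basic_sets X2 f2 \<Longrightarrow> g C \<in> basic_sets X1 f1 \<and> h ` g C \<subseteq> C"
    by auto
  have "inj_on g (basic_sets X2 f2)"
  proof (rule inj_onI)
    fix C C' assume C: "C \<in> basic_sets X2 f2" "C' \<in> basic_sets X2 f2" "g C = g C'"
    \<comment> \<open>Basic sets are nonempty, so a shared choice \<open>g C = g C'\<close> produces
      a point common to \<open>C\<close> and \<open>C'\<close>.\<close>
    obtain x where "x \<in> g C" using g[OF C(1)] unfolding basic_sets_def by blast
    then have "h x \<in> C" "h x \<in> C'" using g[OF C(1)] g[OF C(2)] C(3) by auto
    then show "C = C'" using basic_sets_eq(1)[OF C(1)] basic_sets_eq(1)[OF C(2)] by auto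
  qed
  moreover have "g ` basic_sets X2 f2 \<subseteq> basic_sets X1 f1" using g by auto
  ultimately show ?thesis using fin unfolding TRAC1_def by (meson inj_on_finite)
qed

lemma visible_image:
  assumes X: "dyn_system X1 f1" and h: "continuous_on X1 h" "\<forall>x\<in>X1. h (f1 x) = f2 (h x)"
    and "almost_open X1 X2 h" and BC: "h ` B \<subseteq> C" and B: "visible X1 f1 B"
  shows "visible X2 f2 C"
proof -
  let ?U = "basin X1 f1 B"
  let ?V = "(top_of_set X2) interior_of (h ` ?U)"
  have V: "?V \<noteq> {}"
    using assms(4) B unfolding almost_open_def visible_def basin_def by auto
  have "?V \<subseteq> {y \<in> X2. omega_limit f2 y \<subseteq> C}"
  proof
    fix y assume "y \<in> ?V"
    then have "y \<in> X2" "y \<in> h ` ?U"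
      using interior_of_subset_topspace[of "top_of_set X2" "h ` ?U"]
        interior_of_subset[of "top_of_set X2" "h ` ?U"] by auto
    then obtain x where x: "x \<in> X1" "omega_limit f1 x \<subseteq> B" "y = h x"
      using interior_of_subset[of "top_of_set X1" "{x \<in> X1. omega_limit f1 x \<subseteq> B}"]
      unfolding basin_def by blast
    then show "y \<in> {y \<in> X2. omega_limit f2 y \<subseteq> C}"
      using omega_limit_semiconj[OF X h x(1)] BC \<open>y \<in> X2\<close> by auto
  qed
  then have "?V \<subseteq> basin X2 f2 C"
    unfolding basin_def by (rule interior_of_maximal) simp
  then show ?thesis using V by (auto simp: visible_def)
qed

section \<open>Image measures and their supports\<close>

lemma measurable_restrict_borel:
  assumes "continuous_on X h" "h ` X \<subseteq> Y" "sets M = sets (restrict_space borel X)"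
  shows "h \<in> measurable M (restrict_space borel Y)"
proof -
  have "h \<in> borel_measurable (restrict_space borel X)"
    using assms(1) by (rule borel_measurable_continuous_on_restrict)
  then have "h \<in> measurable (restrict_space borel X) (restrict_space borel Y)"
    using assms(2) by (intro measurable_restrict_space2) (auto simp: space_restrict_space)
  then show ?thesis using measurable_cong_sets[OF assms(3) refl] by blast
qed

lemma space_restrict_borel:
  "sets M = sets (restrict_space borel X) \<Longrightarrow> space M = X"
  by (drule sets_eq_imp_space_eq) (simp add: space_restrict_space)

lemma openin_sets_restrict_borel:
  assumes "sets M = sets (restrict_space borel X)" "openin (top_of_set X) U"
  shows "U \<in> sets M"
  using assms by (auto simp: sets_restrict_space openin_open)

context
  fixes M :: "'a::metric_space measure" and h :: "'a \<Rightarrow> 'b::metric_space" and X Y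
  assumes sM: "sets M = sets (restrict_space borel X)"
    and hc: "continuous_on X h" and hY: "h ` X \<subseteq> Y"
begin

lemma emeasure_pushforward:
  assumes "A \<in> sets (restrict_space borel Y)"
  shows "emeasure (pushforward Y h M) A = emeasure M (h -` A \<inter> X)"
  unfolding pushforward_def
  using measurable_restrict_borel[OF hc hY sM] assms
  by (simp add: emeasure_distr space_restrict_borel[OF sM])

lemma prob_space_pushforward: "prob_space M \<Longrightarrow> prob_space (pushforward Y h M)"
  unfolding pushforward_def
  by (rule prob_space.prob_space_distr[OF _ measurable_restrict_borel[OF hc hY sM]])

lemma support_pushforward:
  assumes X: "compact X"
  shows "support Y (pushforward Y h M) \<subseteq> h ` support X M"
proof
  fix y assume y: "y \<in> support Y (pushforward Y h M)"
  show "y \<in> h ` support X M"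
  proof (rule ccontr)
    assume n: "y \<notin> h ` support X M"
    define \<U> where "\<U> = {U. open U \<and> emeasure M (X \<inter> U) = 0}"
    define F where "F = X \<inter> h -` {y}"
    have "closedin (top_of_set X) F"
      unfolding F_def by (rule continuous_closedin_preimage[OF hc]) simp
    then have "compact F" using X closedin_compact by blast
    moreover have "F \<subseteq> \<Union>\<U>"
    proof
      fix x assume x: "x \<in> F"
      then have "x \<notin> support X M" "x \<in> X" using n by (auto simp: F_def)
      then obtain U where "openin (top_of_set X) U" "x \<in> U" "emeasure M U = 0"
        unfolding support_def by auto
      then show "x \<in> \<Union>\<U>" by (auto simp: openin_open \<U>_def)
    qed
    ultimately obtain \<F> where \<F>: "\<F> \<subseteq> \<U>" "finite \<F>" "F \<subseteq> \<Union>\<F>"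
      by (rule compactE) (auto simp: \<U>_def)
    define W where "W = X \<inter> \<Union>\<F>"
    \<comment> \<open>Measurability is checked too, since \<open>emeasure\<close> is 0 by default on
      nonmeasurable sets.\<close>
    have "X \<inter> U \<in> null_sets M" if "U \<in> \<F>" for U
    proof -
      have "open U" "emeasure M (X \<inter> U) = 0" using that \<F>(1) by (auto simp: \<U>_def)
      then show ?thesis
        using openin_sets_restrict_borel[OF sM openin_open_Int] by (intro null_setsI) auto
    qed
    then have "(\<Union>U\<in>\<F>. X \<inter> U) \<in> null_sets M"
      using \<F>(2) by (intro null_sets.finite_UN)
    moreover have "W = (\<Union>U\<in>\<F>. X \<inter> U)" by (auto simp: W_def)
    ultimately have W0: "W \<in> null_sets M" by simp
    have oW: "open (\<Union>\<F>)" using \<F>(1) by (auto simp: \<U>_def)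
    \<comment> \<open>Removing the image of the compact set outside the cover leaves a relatively
      open neighbourhood of \<open>y\<close> whose preimage lies in the null set
      \<open>W\<close>.\<close>
    have "compact (h ` (X - \<Union>\<F>))"
      by (intro compact_continuous_image continuous_on_subset[OF hc] compact_diff X oW) auto
    then have "open (- h ` (X - \<Union>\<F>))" by (simp add: compact_imp_closed open_Compl)
    then have V: "openin (top_of_set Y) (Y \<inter> (- h ` (X - \<Union>\<F>)))" by (simp add: openin_open_Int)
    have yV: "y \<in> Y \<inter> (- h ` (X - \<Union>\<F>))"
      using y \<F>(3) by (auto simp: support_def F_def)
    have "0 < emeasure (pushforward Y h M) (Y \<inter> (- h ` (X - \<Union>\<F>)))"
      using y V yV unfolding support_def by blast
    also have "\<dots> = emeasure M (h -` (Y \<inter> (- h ` (X - \<Union>\<F>))) \<inter> X)"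
      using openin_sets_restrict_borel[OF refl V] by (rule emeasure_pushforward)
    also have "\<dots> \<le> emeasure M W"
      using W0 by (intro emeasure_mono) (auto simp: W_def)
    also have "\<dots> = 0" using W0 by auto
    finally show False by simp
  qed
qed

end

lemma closedin_support: "closedin (top_of_set X) (support X M)"
proof -
  have "X - support X M = \<Union>{U. openin (top_of_set X) U \<and> emeasure M U = 0}"
    using openin_subset by (fastforce simp: support_def)
  then have "openin (top_of_set X) (X - support X M)" by auto
  then show ?thesis by (auto simp: closedin_def support_def)
qed

text \<open>Two measures appear because TRAC 4 evaluates the background measure on supports of the
  ergodic measures.\<close>

lemma support_sets:
  assumes "sets M = sets (restrict_space borel X)"
  shows "support X N \<in> sets M"
proof -
  obtain T where "closed T" "support X N = X \<inter> T"
    using closedin_support[of X N] by (auto simp: closedin_closed)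
  then show ?thesis using assms by (auto simp: sets_restrict_space)
qed

section \<open>Image of the background measure, ergodicity and generic points\<close>

text \<open>Fullness transfers because the preimage of a nonempty open set is open by continuity and
  nonempty by surjectivity.\<close>

lemma background_measure_pushforward:
  assumes m: "background_measure X m" and h: "continuous_on X h" "h ` X = Y"
  shows "background_measure Y (pushforward Y h m)"
  unfolding background_measure_def
proof (intro conjI allI impI)
  have sm: "sets m = sets (restrict_space borel X)" and "prob_space m"
    using m by (auto simp: background_measure_def)
  then show "prob_space (pushforward Y h m)"
    using prob_space_pushforward[OF sm h(1)] h(2) by auto
  show "sets (pushforward Y h m) = sets (restrict_space borel Y)" by (simp add: pushforward_def)
  fix U assume U: "openin (top_of_set Y) U \<and> U \<noteq> {}"
  have "openin (top_of_set X) (X \<inter> h -` U)"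
    by (rule continuous_openin_preimage[OF h(1), of Y]) (use h(2) U in auto)
  moreover have "X \<inter> h -` U \<noteq> {}" using U h(2) openin_subset[of "top_of_set Y" U] by auto
  ultimately have "0 < emeasure m (X \<inter> h -` U)" using m by (auto simp: background_measure_def)
  then show "0 < emeasure (pushforward Y h m) U"
    using emeasure_pushforward[OF sm h(1) _ openin_sets_restrict_borel[OF refl conjunct1[OF U]]] h(2)
    by (simp add: Int_commute)
qed

lemma ergodic_pushforward:
  assumes X: "dyn_system X1 f1" "dyn_system X2 f2"
    and h: "continuous_on X1 h" "h ` X1 = X2" "\<forall>x\<in>X1. h (f1 x) = f2 (h x)"
    and m: "ergodic X1 f1 m"
  shows "ergodic X2 f2 (pushforward X2 h m)"
proof -
  have sm: "sets m = sets (restrict_space borel X1)" and p: "prob_space m"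
    and inv: "\<And>A. A \<in> sets m \<Longrightarrow> emeasure m (f1 -` A \<inter> X1) = emeasure m A"
    and erg: "\<And>A. A \<in> sets m \<Longrightarrow> f1 -` A \<inter> X1 = A \<Longrightarrow> emeasure m A = 0 \<or> emeasure m A = 1"
    using m by (auto simp: ergodic_def invariant_prob_def)
  let ?n = "pushforward X2 h m"
  have sn: "sets ?n = sets (restrict_space borel X2)" by (simp add: pushforward_def)
  have f1X: "f1 ` X1 \<subseteq> X1" using X by (simp add: dyn_system_def)
  have hX: "h ` X1 \<subseteq> X2" using h(2) by simp
  have pre: "h -` A \<inter> X1 \<in> sets m" if "A \<in> sets ?n" for A
    using measurable_sets[OF measurable_restrict_borel[OF h(1) hX sm]] that
    by (simp add: sn space_restrict_borel[OF sm])
  have em: "emeasure ?n A = emeasure m (h -` A \<inter> X1)" if "A \<in> sets ?n" for A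
    using emeasure_pushforward[OF sm h(1) hX] that sn by simp
  have f2m: "f2 -` A \<inter> X2 \<in> sets ?n" if "A \<in> sets ?n" for A
    using measurable_sets[OF measurable_restrict_borel[of X2 f2 X2 ?n]] that X(2) sn
    by (simp add: dyn_system_def space_restrict_borel[OF sn])
  \<comment> \<open>This identity carries both invariance of the measure and invariance of a set
    from the factor to \<open>X1\<close>.\<close>
  have comm: "h -` (f2 -` A \<inter> X2) \<inter> X1 = f1 -` (h -` A \<inter> X1) \<inter> X1" for A
    using f1X h by auto
  have "invariant_prob X2 f2 ?n"
    unfolding invariant_prob_def
  proof (intro conjI ballI)
    show "prob_space ?n" by (rule prob_space_pushforward[OF sm h(1) hX p])
    show "sets ?n = sets (restrict_space borel X2)" by (rule sn)
    fix A assume A: "A \<in> sets ?n"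
    show "emeasure ?n (f2 -` A \<inter> X2) = emeasure ?n A"
      unfolding em[OF A] em[OF f2m[OF A]] comm by (rule inv[OF pre[OF A]])
  qed
  moreover have "emeasure ?n A = 0 \<or> emeasure ?n A = 1" if "A \<in> sets ?n" "f2 -` A \<inter> X2 = A" for A
    using erg[OF pre[OF that(1)]] comm[of A] unfolding em[OF that(1)] that(2) by simp
  ultimately show ?thesis unfolding ergodic_def by blast
qed

text \<open>A test function \<open>u\<close> on \<open>Y\<close> is pulled back to \<open>u\<close>
  after \<open>h\<close>: the time averages agree along conjugate orbits, and the integrals agree by
  change of variables.\<close>

lemma Gen_pushforward:
  assumes X: "dyn_system X f1"
    and h: "continuous_on X h" "h ` X \<subseteq> Y" "\<forall>x\<in>X. h (f1 x) = f2 (h x)"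
    and sm: "sets m = sets (restrict_space borel X)"
    and x: "x \<in> Gen X f1 m"
  shows "h x \<in> Gen Y f2 (pushforward Y h m)"
  unfolding Gen_def
proof (intro CollectI conjI allI impI)
  have xX: "x \<in> X" using x by (simp add: Gen_def)
  then show "h x \<in> Y" using h(2) by auto
  fix u :: "'b \<Rightarrow> real" assume u: "continuous_on Y u"
  have "continuous_on X (\<lambda>x. u (h x))"
    by (rule continuous_on_compose2[OF u h(1,2)])
  then have "(\<lambda>n. (\<Sum>i<n. u (h ((f1 ^^ i) x))) / real n) \<longlonglongrightarrow> integral\<^sup>L m (\<lambda>x. u (h x))"
    using x by (auto simp: Gen_def)
  moreover have "h ((f1 ^^ i) x) = (f2 ^^ i) (h x)" for i
    using X h(3) xX by (intro semiconj_funpow[of f1 X]) (auto simp: dyn_system_def)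
  moreover have "integral\<^sup>L (pushforward Y h m) u = integral\<^sup>L m (\<lambda>x. u (h x))"
    unfolding pushforward_def
    by (rule integral_distr[OF measurable_restrict_borel[OF h(1,2) sm]
          borel_measurable_continuous_on_restrict[OF u]])
  ultimately show "(\<lambda>n. (\<Sum>i<n. u ((f2 ^^ i) (h x))) / real n) \<longlonglongrightarrow> integral\<^sup>L (pushforward Y h m) u"
    by simp
qed

section \<open>Regularity and the transfer of almost-everywhere statements\<close>

text \<open>A closed set is the intersection of its shrinking open neighbourhoods, and the
  approximation property survives complements and countable unions; so it holds on the sigma-algebra
  generated by the closed sets.\<close>

lemma finite_borel_measure_regular:
  fixes M :: "'a::metric_space measure"
  assumes "finite_measure M" and sM: "sets M = sets borel" and B: "B \<in> sets borel" and "e > 0"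
  shows "\<exists>K U. closed K \<and> open U \<and> K \<subseteq> B \<and> B \<subseteq> U \<and> measure M (U - K) < e"
proof -
  interpret finite_measure M by fact
  have small: "\<exists>n. measure M (A n) < e"
    if "\<And>n. A n \<in> sets borel" "decseq A" "measure M (\<Inter>n. A n) < e" for A and e :: real
  proof -
    have "(\<lambda>n. measure M (A n)) \<longlonglongrightarrow> measure M (\<Inter>n. A n)"
      using that by (intro finite_Lim_measure_decseq) (auto simp: sM)
    then have "eventually (\<lambda>n. measure M (A n) < e) sequentially"
      using that(3) by (rule order_tendstoD)
    then show ?thesis by (auto simp: eventually_sequentially)
  qed
  have "B \<in> sigma_sets UNIV (Collect closed)"
    using B by (simp add: borel_eq_closed)
  \<comment> \<open>The tolerance is quantified inside the induction because the union case needs a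
    different one for each member.\<close>
  then have "\<forall>e>0. \<exists>K U. closed K \<and> open U \<and> K \<subseteq> B \<and> B \<subseteq> U \<and> measure M (U - K) < e"
  proof induction
    case (Basic B)
    show ?case
    proof (intro allI impI)
      fix e :: real assume e: "e > 0"
      define U where "U n = (\<Union>x\<in>B. ball x (inverse (real (Suc n))))" for n
      have oU: "open (U n)" "B \<subseteq> U n" for n by (auto simp: U_def)
      have "(\<Inter>n. U n) \<subseteq> closure B"
      proof
        fix z assume z: "z \<in> (\<Inter>n. U n)"
        show "z \<in> closure B"
          unfolding closure_approachable
        proof (intro allI impI)
          fix r :: real assume "r > 0"
          then obtain n where n: "inverse (real (Suc n)) < r" using reals_Archimedean by blast
          obtain x where "x \<in> B" "dist x z < inverse (real (Suc n))"
            using z by (auto simp: U_def)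
          with n show "\<exists>x\<in>B. dist x z < r" by (meson less_trans)
        qed
      qed
      then have empty: "(\<Inter>n. U n - B) = {}" using Basic by auto
      have "decseq (\<lambda>n. U n - B)"
      proof (rule antimonoI)
        fix m n :: nat assume "m \<le> n"
        then have "inverse (real (Suc n)) \<le> inverse (real (Suc m))"
          by (simp add: divide_simps)
        then have "ball x (inverse (real (Suc n))) \<subseteq> ball x (inverse (real (Suc m)))" for x :: 'a
          by (rule subset_ball)
        then have "U n \<subseteq> U m" unfolding U_def by blast
        then show "U n - B \<subseteq> U m - B" by auto
      qed
      moreover have "U n - B \<in> sets borel" for n using oU Basic by auto
      moreover have "measure M (\<Inter>n. U n - B) < e" unfolding empty using e by simp
      ultimately obtain n where "measure M (U n - B) < e"
        using small[of "\<lambda>n. U n - B" e] by metis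
      then show "\<exists>K U. closed K \<and> open U \<and> K \<subseteq> B \<and> B \<subseteq> U \<and> measure M (U - K) < e"
        using oU Basic by blast
    qed
  next
    case Empty
    then show ?case by (intro allI impI exI[of _ "{}"]) simp
  next
    case (Compl B)
    show ?case
    proof (intro allI impI)
      fix e :: real assume "e > 0"
      then obtain K U where KU: "closed K" "open U" "K \<subseteq> B" "B \<subseteq> U" "measure M (U - K) < e"
        using Compl.IH by meson
      \<comment> \<open>Complementation exchanges the inner and the outer approximation without
        changing their difference.\<close>
      have "- K - - U = U - K" by auto
      then show "\<exists>K U. closed K \<and> open U \<and> K \<subseteq> UNIV - B \<and> UNIV - B \<subseteq> U \<and> measure M (U - K) < e"
        using KU by (intro exI[of _ "- U"] exI[of _ "- K"]) (simp add: closed_Compl open_Compl Compl_eq_Diff_UNIV[symmetric])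
    qed
  next
    case (Union B)
    show ?case
    proof (intro allI impI)
      fix e :: real assume e: "e > 0"
      \<comment> \<open>The tolerances form a geometric series with sum \<open>e/2\<close>, which
        leaves the final bound strictly below \<open>e\<close>.\<close>
      have "\<forall>i. \<exists>K U. closed K \<and> open U \<and> K \<subseteq> B i \<and> B i \<subseteq> U \<and> measure M (U - K) < e/2 * (1/2)^Suc i"
      proof
        fix i
        have "e/2 * (1/2)^Suc i > 0" using e by simp
        then show "\<exists>K U. closed K \<and> open U \<and> K \<subseteq> B i \<and> B i \<subseteq> U \<and> measure M (U - K) < e/2 * (1/2)^Suc i"
          using Union.IH by meson
      qed
      then obtain K U where KU: "\<And>i. closed (K i)" "\<And>i. open (U i)" "\<And>i. K i \<subseteq> B i" "\<And>i. B i \<subseteq> U i"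
        "\<And>i. measure M (U i - K i) < e/2 * (1/2)^Suc i"
        by metis
      have sums: "(\<lambda>i. e/2 * (1/2)^Suc i) sums (e/2)"
        using sums_mult[OF power_half_series, of "e/2"] by simp
      have summ: "summable (\<lambda>i. measure M (U i - K i))"
        by (rule summable_comparison_test'[OF sums_summable[OF sums]])
           (use KU(5) in \<open>auto intro: less_imp_le\<close>)
      have mb: "K i \<in> sets borel" "U i \<in> sets borel" for i using KU by auto
      have "measure M ((\<Union>i. U i) - (\<Union>i. K i)) \<le> measure M (\<Union>i. U i - K i)"
        using mb by (intro finite_measure_mono) (auto simp: sM)
      also have "\<dots> \<le> (\<Sum>i. measure M (U i - K i))"
        using mb by (intro finite_measure_subadditive_countably summ) (auto simp: sM)
      also have "\<dots> \<le> (\<Sum>i. e/2 * (1/2)^Suc i)"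
        using KU(5) by (intro suminf_le summ sums_summable[OF sums]) (auto intro: less_imp_le)
      also have "\<dots> < e" using sums_unique[OF sums] e by simp
      finally have lt: "measure M ((\<Union>i. U i) - (\<Union>i. K i)) < e" .
      \<comment> \<open>Only finitely many \<open>K i\<close> are kept, so that their union is
        closed; continuity from above makes the resulting error as small as required.\<close>
      define A where "A n = (\<Union>i. U i) - (\<Union>i\<le>n. K i)" for n :: nat
      have "(\<Inter>n. A n) = (\<Union>i. U i) - (\<Union>i. K i)" by (auto simp: A_def)
      moreover have "decseq A"
        by (rule antimonoI) (fastforce simp: A_def)
      moreover have "A n \<in> sets borel" for n unfolding A_def using mb by (intro sets.Diff) auto
      ultimately obtain n where n: "measure M (A n) < e" using small[of A e] lt by auto
      have "closed (\<Union>i\<le>n. K i)" "open (\<Union>i. U i)" using KU by auto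
      moreover have "(\<Union>i\<le>n. K i) \<subseteq> (\<Union>i. B i)" "(\<Union>i. B i) \<subseteq> (\<Union>i. U i)"
        by (intro UN_mono KU(3,4) subset_UNIV)+
      ultimately show "\<exists>K U. closed K \<and> open U \<and> K \<subseteq> (\<Union>i. B i) \<and> (\<Union>i. B i) \<subseteq> U \<and> measure M (U - K) < e"
        using n unfolding A_def by meson
    qed
  qed
  with \<open>e > 0\<close> show ?thesis by blast
qed

text \<open>No measurability of \<^term>\<open>Q\<close> is assumed, so \<open>AE_distr_iff\<close> does not apply. Instead, regularity
  yields a sigma-compact set of full measure on which \<^term>\<open>Q \<circ> h\<close> holds, and its image is Borel.\<close>
lemma AE_pushforward:
  fixes m :: "'a::metric_space measure" and h :: "'a \<Rightarrow> 'b::metric_space"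
  assumes X: "compact X" and m: "prob_space m" "sets m = sets (restrict_space borel X)"
    and h: "continuous_on X h" "h ` X \<subseteq> Y"
    and ae: "AE x in m. Q (h x)"
  shows "AE y in pushforward Y h m. Q y"
proof -
  interpret m: prob_space m by fact
  note spm = space_restrict_borel[OF m(2)]
  have cX: "X \<in> sets borel" by (intro borel_closed compact_imp_closed X)
  obtain N where N: "{x \<in> space m. \<not> Q (h x)} \<subseteq> N" "emeasure m N = 0" "N \<in> sets m"
    using AE_E[OF ae] by blast
  have Nb: "N \<in> sets borel" using N(3) cX by (auto simp: m(2) sets_restrict_space)
  \<comment> \<open>This extends \<open>m\<close> to the Borel sets of the whole type, giving mass
    zero to the complement of \<open>X\<close>, so that regularity applies.\<close>
  define M where "M = distr m borel (\<lambda>x. x)"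
  have idm: "(\<lambda>x. x) \<in> borel_measurable m"
    using measurable_cong_sets[OF m(2) refl] borel_measurable_continuous_on_restrict[OF continuous_on_id]
    by blast
  interpret M: prob_space M unfolding M_def by (rule m.prob_space_distr[OF idm])
  have Mm: "measure M A = measure m (A \<inter> X)" if "A \<in> sets borel" for A
    unfolding M_def using idm that by (simp add: measure_distr spm)
  have "\<exists>U. open U \<and> N \<subseteq> U \<and> measure m (U \<inter> X) < inverse (real (Suc n))" for n
  proof -
    obtain K U where KU: "closed K" "open U" "K \<subseteq> N" "N \<subseteq> U" "measure M (U - K) < inverse (real (Suc n))"
      using finite_borel_measure_regular[OF M.finite_measure_axioms _ Nb, of "inverse (real (Suc n))"]
      by (auto simp: M_def)
    have NX: "N \<inter> X = N" using N(3) sets.sets_into_space spm by blast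
    \<comment> \<open>Since \<open>K \<subseteq> N\<close>, the part of \<open>U\<close> outside
      \<open>U - K\<close> lies in the null set \<open>N\<close>.\<close>
    have "measure M U \<le> measure M ((U - K) \<union> N)"
      using KU Nb by (intro M.finite_measure_mono) (auto simp: M_def)
    also have "\<dots> \<le> measure M (U - K) + measure M N"
      using KU Nb by (intro measure_Un_le) (auto simp: M_def)
    also have "measure M N = 0" using N(2) Mm[OF Nb] unfolding NX by (simp add: Sigma_Algebra.measure_def[of m])
    finally show ?thesis using KU Mm[of U] by auto
  qed
  then obtain U where U: "\<And>n. open (U n)" "\<And>n. N \<subseteq> U n"
    "\<And>n. measure m (U n \<inter> X) < inverse (real (Suc n))"
    by metis
  \<comment> \<open>Each \<open>X - U n\<close> is compact and avoids \<open>N\<close>, so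
    \<open>Q\<close> holds on its image. The preimage of \<open>Y - S\<close> lies in every
    \<open>U n\<close> and is therefore null.\<close>
  define S where "S = (\<Union>n. h ` (X - U n))"
  have "compact (h ` (X - U n))" for n
    by (intro compact_continuous_image continuous_on_subset[OF h(1)] compact_diff X U) auto
  then have "S \<in> sets borel" unfolding S_def by (intro sets.countable_UN) (auto intro!: borel_closed compact_imp_closed)
  then have YS: "Y - S \<in> sets (restrict_space borel Y)"
    by (auto simp: sets_restrict_space intro!: image_eqI[of _ _ "- S"])
  have YSm: "emeasure (pushforward Y h m) (Y - S) = emeasure m (h -` (Y - S) \<inter> X)"
    by (rule emeasure_pushforward[OF m(2) h YS])
  have "measure m (h -` (Y - S) \<inter> X) \<le> measure m (U n \<inter> X)" for n
    using U(1) by (intro m.finite_measure_mono) (auto simp: S_def m(2) sets_restrict_space)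
  then have less: "measure m (h -` (Y - S) \<inter> X) < inverse (real (Suc n))" for n
    using U(3) by (meson le_less_trans)
  have "measure m (h -` (Y - S) \<inter> X) \<le> 0"
  proof (rule ccontr)
    assume "\<not> ?thesis"
    then obtain n where "inverse (real (Suc n)) < measure m (h -` (Y - S) \<inter> X)"
      using reals_Archimedean[of "measure m (h -` (Y - S) \<inter> X)"] by auto
    with less[of n] show False by simp
  qed
  then have "emeasure m (h -` (Y - S) \<inter> X) = 0"
    by (simp add: m.emeasure_eq_measure measure_le_0_iff)
  then have "Y - S \<in> null_sets (pushforward Y h m)"
    using YS YSm by (auto simp: null_sets_def pushforward_def)
  moreover have "{y \<in> space (pushforward Y h m). \<not> Q y} \<subseteq> Y - S"
    using N(1) U(2) spm by (auto simp: S_def pushforward_def space_restrict_space)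
  ultimately show ?thesis by (rule AE_I')
qed


section \<open>Transfer of the tractability conditions\<close>

theorem theorem2p7:
  fixes X1 :: "'a::metric_space set" and f1 :: "'a \<Rightarrow> 'a"
    and X2 :: "'b::metric_space set" and f2 :: "'b \<Rightarrow> 'b"
    and h :: "'a \<Rightarrow> 'b" and m0 :: "'a measure"
    and k :: nat and mu :: "nat \<Rightarrow> 'a measure"
  assumes sys1: "dyn_system X1 f1" and sys2: "dyn_system X2 f2"
    and h_cont: "continuous_on X1 h" and h_onto: "h ` X1 = X2"
    and h_conj: "\<forall>x \<in> X1. h (f1 x) = f2 (h x)"
    and bg: "background_measure X1 m0"
    and T1: "TRAC1 X1 f1" and T2: "TRAC2 X1 f1 m0 k mu"
  shows "background_measure X2 (pushforward X2 h m0)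
      \<and> TRAC1 X2 f2
      \<and> TRAC2 X2 f2 (pushforward X2 h m0) k (\<lambda>i. pushforward X2 h (mu i))
      \<and> (almost_open X1 X2 h \<and> TRAC3 X1 f1 k mu \<longrightarrow>
           TRAC3 X2 f2 k (\<lambda>i. pushforward X2 h (mu i)))
      \<and> (almost_open X1 X2 h \<and> TRAC3 X1 f1 k mu \<and> almost_one_to_one X1 m0 h
           \<and> TRAC4 X1 m0 k mu \<longrightarrow>
           TRAC4 X2 (pushforward X2 h m0) k (\<lambda>i. pushforward X2 h (mu i)))"
proof (intro conjI impI)
  have cX: "compact X1" using sys1 by (simp add: dyn_system_def)
  have hX: "h ` X1 \<subseteq> X2" using h_onto by simp
  have sm0: "sets m0 = sets (restrict_space borel X1)" and pm0: "prob_space m0"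
    using bg by (auto simp: background_measure_def)
  have erg: "\<And>i. i < k \<Longrightarrow> ergodic X1 f1 (mu i)"
    and gen: "AE x in m0. \<exists>i<k. x \<in> Gen X1 f1 (mu i)"
    using T2 by (auto simp: TRAC2_def)
  have smu: "sets (mu i) = sets (restrict_space borel X1)" if "i < k" for i
    using erg[OF that] by (auto simp: ergodic_def invariant_prob_def)
  have supp: "support X2 (pushforward X2 h (mu i)) \<subseteq> h ` support X1 (mu i)" if "i < k" for i
    by (rule support_pushforward[OF smu[OF that] h_cont hX cX])
  show "background_measure X2 (pushforward X2 h m0)"
    by (rule background_measure_pushforward[OF bg h_cont h_onto])
  show "TRAC1 X2 f2"
    by (rule TRAC1_factor[OF sys1 sys2 h_cont h_onto h_conj T1])
  \<comment> \<open>Genericity is first transferred pointwise, still almost everywhere upstairs, and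
    only then moved to the image measure.\<close>
  have "AE x in m0. \<exists>i<k. h x \<in> Gen X2 f2 (pushforward X2 h (mu i))"
    using gen by eventually_elim (use Gen_pushforward[OF sys1 h_cont hX h_conj smu] in blast)
  then have "AE y in pushforward X2 h m0. \<exists>i<k. y \<in> Gen X2 f2 (pushforward X2 h (mu i))"
    by (rule AE_pushforward[OF cX pm0 sm0 h_cont hX])
  then show "TRAC2 X2 f2 (pushforward X2 h m0) k (\<lambda>i. pushforward X2 h (mu i))"
    using ergodic_pushforward[OF sys1 sys2 h_cont h_onto h_conj erg] by (simp add: TRAC2_def)
  show "TRAC3 X2 f2 k (\<lambda>i. pushforward X2 h (mu i))"
    if A: "almost_open X1 X2 h \<and> TRAC3 X1 f1 k mu"
    unfolding TRAC3_def
  proof (intro allI impI)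
    fix i assume i: "i < k"
    then obtain B where B: "B \<in> basic_sets X1 f1" "support X1 (mu i) \<subseteq> B" "visible X1 f1 B"
      using A by (auto simp: TRAC3_def)
    obtain C where C: "C \<in> basic_sets X2 f2" "h ` B \<subseteq> C"
      using basic_sets_image[OF sys1 h_cont hX h_conj B(1)] by blast
    have "visible X2 f2 C"
      using A by (intro visible_image[OF sys1 h_cont h_conj _ C(2) B(3)]) simp
    then show "\<exists>B\<in>basic_sets X2 f2. support X2 (pushforward X2 h (mu i)) \<subseteq> B \<and> visible X2 f2 B"
      using C image_mono[OF B(2), of h] supp[OF i] by (intro bexI[of _ C] conjI) (auto intro: subset_trans)
  qed
  show "TRAC4 X2 (pushforward X2 h m0) k (\<lambda>i. pushforward X2 h (mu i))"
    if A: "almost_open X1 X2 h \<and> TRAC3 X1 f1 k mu \<and> almost_one_to_one X1 m0 h \<and> TRAC4 X1 m0 k mu"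
    unfolding TRAC4_def
  proof (intro allI impI)
    fix i j assume ij: "i < k" "j < k" "i \<noteq> j"
    let ?S = "support X2 (pushforward X2 h (mu i)) \<inter> support X2 (pushforward X2 h (mu j))"
    have S: "?S \<in> sets (restrict_space borel X2)" by (intro sets.Int support_sets refl)
    \<comment> \<open>TRAC 4 only says that \<open>emeasure\<close> is 0; with measurability of the
      supports this becomes a genuine null set.\<close>
    have "support X1 (mu i) \<inter> support X1 (mu j) \<in> null_sets m0"
      using A ij by (auto simp: TRAC4_def null_sets_def intro!: sets.Int support_sets[OF sm0])
    then have "AE x in m0. x \<notin> support X1 (mu i) \<inter> support X1 (mu j)" by (rule AE_not_in)
    moreover have "AE x in m0. {y \<in> X1. h y = h x} = {x}"
      using A by (simp add: almost_one_to_one_def)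
    ultimately have ae: "AE x in m0. x \<notin> h -` ?S \<inter> X1"
    proof eventually_elim
      case (elim x)
      show ?case
      proof
        assume "x \<in> h -` ?S \<inter> X1"
        then obtain a b where "a \<in> support X1 (mu i)" "h a = h x" "b \<in> support X1 (mu j)" "h b = h x"
          using supp[OF ij(1)] supp[OF ij(2)] by (auto simp: image_iff subset_iff) metis
        moreover from this have "a = x" "b = x" using elim(2) by (auto simp: support_def)
        ultimately show False using elim(1) by blast
      qed
    qed
    \<comment> \<open>Measurability of this preimage turns the almost-everywhere statement into
      measure zero.\<close>
    have "h -` ?S \<inter> X1 \<in> sets m0"
      using measurable_sets[OF measurable_restrict_borel[OF h_cont hX sm0] S]
      by (simp add: space_restrict_borel[OF sm0])
    then have "emeasure m0 (h -` ?S \<inter> X1) = 0"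
      using ae by (simp add: AE_iff_null_sets null_setsD1)
    then show "emeasure (pushforward X2 h m0) ?S = 0"
      using emeasure_pushforward[OF sm0 h_cont hX S] by simp
  qed
qed

end
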